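(* Let $E_J$ be a $W$-graph ideal for the weighted Coxeter system $(W,S,L)$ and let $x,y\in E_J$. (1) If $x<y$, then $Q_{x,y}=L_{\frac{L(y)-L(x)}2}\Big(\sum_{\varphi\in\mathscr{J}(x,y)}\widetilde{\mathscr{R}}^{*}_\varphi\Big)$. (2) If $x\leqslant y$, then $Q_{x,y}=\sum_{\varphi\in\mathscr{M}(x,y)}\widetilde{\mathscr{R}}^{*}_\varphi$ (a sum with only finitely many nonzero terms).
   Context: Setting. $(W,S)$ is a Coxeter system with length function $\ell$ and Bruhat order $\leqslant$; $\epsilon_w=(-1)^{\ell(w)}$. $\Gamma$ is a totally ordered abelian group (written additively). $\mathbb{Z}[\Gamma]$ is its group ring with $\mathbb{Z}$-basis $\{q^\gamma\mid\gamma\in\Gamma\}$, $q^\gamma q^\zeta=q^{\gamma+\zeta}$; $[q^\gamma](f)$ is the coefficient of $q^\gamma$ in $f$; $\mathsf{deg}(f)$ is the largest $\gamma$ with $[q^\gamma](f)\neq0$, $\mathsf{deg}(0)=-\infty$. The bar is the ring automorphism $q^\gamma\mapsto q^{-\gamma}$. $L:W\to\Gamma$ is a weight: $L(w)=L(s_1)+\cdots+L(s_k)$ for every reduced word $w=s_1\cdots s_k$, and $L(s)\geqslant0$ for all $s\in S$. Put $q_w=q^{L(w)}$. $\mathscr{H}$ is the Hecke algebra over $\mathbb{Z}[\Gamma]$ with basis $\{T_w\}_{w\in W}$, $T_sT_w=T_{sw}$ if $\ell(sw)>\ell(w)$, $T_sT_w=q_sT_{sw}+(q_s-1)T_w$ if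 $\ell(sw)<\ell(w)$, with bar involution (semilinear ring involution) $\overline{T_s}=q_s^{-1}T_s+(q_s^{-1}-1)$. $W$-graph ideal. $x$ is a suffix of $y$ ($x\leqslant_L y$) if $y=zx$ with $\ell(y)=\ell(z)+\ell(x)$. Let $E\subseteq W$ be an ideal of $(W,\leqslant_L)$, i.e. every suffix of an element of $E$ is in $E$. For $J\subseteq S$, $D_J=\{w\mid\ell(ws)>\ell(w)\ \forall s\in J\}$. Let $J\subseteq\{s\in S\mid\ell(xs)>\ell(x)\ \forall x\in E\}$, so $E\subseteq D_J$; write $E_J$ for $E$ with this $J$. For $y\in E_J$: $SD(y)=\{s\mid\ell(sy)<\ell(y)\}$, $SA(y)=\{s\mid\ell(sy)>\ell(y),sy\in E_J\}$, $WD(y)=\{s\mid\ell(sy)>\ell(y),sy\notin D_J\}$, $WA(y)=\{s\mid\ell(sy)>\ell(y),sy\in D_J\setminus E_J\}$. $E_J$ is a $W$-graph ideal if there is an $\mathscr{H}$-module $M(E_J,L)$, free over $\mathbb{Z}[\Gamma]$ with basis $\{\Gamma_y\mid y\in E_J\}$, such that $T_s\Gamma_y$ equals $q_s\Gamma_{sy}+(q_s-1)\Gamma_y$ if $s\in SD(y)$; $\Gamma_{sy}$ if $s\in SA(y)$; $-\Gamma_y$ if $s\in WD(y)$; $q_s\Gamma_y-\sum_{z<sy,\,z\in E_J}r^s_{z,y}\Gamma_z$ if $s\in WA(y)$, for some $r^s_{z,y}\in q_s\mathbb{Z}[\Gamma]$; and $M(E_J,L)$ admits a $\mathbb{Z}[\Gamma]$-semilinear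 involution $m\mapsto\overline m$ with $\overline{\Gamma_1}=\Gamma_1$ and $\overline{T_w\Gamma_y}=\overline{T_w}\,\overline{\Gamma_y}$ for all $w\in W,y\in E_J$. Fix such a module. $R$-polynomials. $R_{x,y}\in\mathbb{Z}[\Gamma]$ ($x,y\in E_J$) are defined by $\overline{\Gamma_y}=\sum_{x\in E_J}\epsilon_x\epsilon_yq_y^{-1}R_{x,y}\Gamma_x$. Standing facts: $R_{x,y}=0$ if $x\not\leqslant y$, $R_{x,x}=1$, and for $x\leqslant y$ all exponents $\gamma$ occurring in $R_{x,y}$ lie in the subgroup of $\Gamma$ generated by $\{L(s)\mid s\in S\}$ and satisfy $0\leqslant\gamma\leqslant L(y)-L(x)$. The dual $R$-polynomials $\widetilde R_{x,y}$ are determined by $\overline{R_{x,y}}=\epsilon_x\epsilon_yq_xq_y^{-1}\widetilde R_{x,y}$. Kazhdan–Lusztig polynomials. $P_{x,y}\in\mathbb{Z}[\Gamma]$ ($x,y\in E_J$) is the unique family with $P_{x,y}=0$ if $x\not\leqslant y$, $P_{x,x}=1$, $\mathsf{deg}(P_{x,y})<\frac{L(y)-L(x)}2$ for $x<y$, and $q_x^{-1}q_y\overline{P_{x,y}}=\sum_{x\leqslant t\leqslant y,\,t\in E_J}R_{x,t}P_{t,y}$. The inverse weighted Kazhdan–Lusztig polynomials $Q_{x,y}$ ($x,y\in E_J$) are given recursively by $Q_{x,y}=0$ if $x\not\leqslant y$ and $\sum_{x\leqslant t\leqslant y,\,t\in E_J}\epsilon_t\epsilon_yQ_{x,t}P_{t,y}=\delta_{x,y}$.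 Truncations. $U_\zeta(\sum_\gamma a_\gamma q^\gamma)=\sum_{\gamma>\zeta}a_\gamma q^\gamma$, $L_\zeta(\sum_\gamma a_\gamma q^\gamma)=\sum_{\gamma<\zeta}a_\gamma q^\gamma$. Halves are taken in the divisible hull of $\Gamma$: $\gamma>\zeta/2$ means $2\gamma>\zeta$. Chains. For $k\geqslant0$, $\mathscr{J}_k(x,y)$ is the set of $E_J$-chains $x=x_0<x_1<\cdots<x_{k+1}=y$ with all $x_i\in E_J$ and $\mathscr{M}_k(x,y)$ the set of $E_J$-multichains $x=x_0\leqslant x_1\leqslant\cdots\leqslant x_{k+1}=y$ with all $x_i\in E_J$ (Bruhat order); $\mathscr{J}(x,y)=\bigcup_{k\geqslant0}\mathscr{J}_k(x,y)$, $\mathscr{M}(x,y)=\bigcup_{k\geqslant0}\mathscr{M}_k(x,y)$. $\widetilde{\mathscr{R}}^*$-polynomials. For a multichain $\varphi:x=x_0\leqslant x_1\leqslant\cdots\leqslant x_{r+1}=y$, define recursively $\widetilde{\mathscr{R}}^*_\varphi=\widetilde{\mathscr{R}}^*_{x,y}:=q_x^{-1}q_y\overline{\widetilde R_{x,y}}$ if $r=0$, and $\widetilde{\mathscr{R}}^*_\varphi=U_{\frac{L(x_r)-L(x)}2}\big(q_x^{-1}q_{x_r}\overline{\widetilde{\mathscr{R}}^*_{\varphi'}}\big)\,\widetilde{\mathscr{R}}^*_{x_r,y}$ if $r\geqslant1$, where $\varphi':x=x_0\leqslant x_1\leqslant\cdots\leqslant x_r$. *)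

theory Defs
  imports
    "HOL-Algebra.Multiplicative_Group"
    "HOL-Algebra.Generated_Groups"
    "HOL-Library.Poly_Mapping"
begin

section \<open>The group ring of a totally ordered abelian group\<close>

text \<open>The group ring \<open>\<int>[\<Gamma>]\<close> is the type of finitely supported functions from \<open>\<Gamma>\<close> to
  \<^typ>\<open>int\<close>, whose library multiplication is convolution. The exponent group \<open>\<Gamma>\<close> is
  a type of class \<^class>\<open>linordered_ab_group_add\<close>.\<close>

type_synonym 'g gring = "'g \<Rightarrow>\<^sub>0 int"

definition q :: "'g \<Rightarrow> 'g gring"
  where "q \<gamma> = Poly_Mapping.single \<gamma> 1"

definition gbar :: "'g::ab_group_add gring \<Rightarrow> 'g gring"
  where "gbar f = Poly_Mapping.map_key uminus f"

lemma lookup_gbar: "Poly_Mapping.lookup (gbar f) \<gamma> = Poly_Mapping.lookup f (- \<gamma>)"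
  unfolding gbar_def by (simp add: Poly_Mapping.map_key.rep_eq inj_def)

text \<open>The degree is only meaningful for a nonzero argument; the convention
  \<open>deg 0 = -\<infinity>\<close> enters through the case distinction in the next definition.\<close>

definition deg :: "'g::linorder gring \<Rightarrow> 'g"
  where "deg f = Max (Poly_Mapping.keys f)"

definition deg_less_half :: "'g::linordered_ab_group_add gring \<Rightarrow> 'g \<Rightarrow> bool"
  where "deg_less_half f \<zeta> \<longleftrightarrow> f = 0 \<or> deg f + deg f < \<zeta>"

text \<open>The truncations at \<open>\<zeta>/2\<close>, a point of the divisible hull of \<open>\<Gamma>\<close>.\<close>

lift_definition U_half :: "'g::linordered_ab_group_add \<Rightarrow> 'g gring \<Rightarrow> 'g gring"
  is "\<lambda>\<zeta> a \<gamma>. if \<zeta> < \<gamma> + \<gamma> then a \<gamma> else 0"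
  by (erule rev_finite_subset) auto

lift_definition L_half :: "'g::linordered_ab_group_add \<Rightarrow> 'g gring \<Rightarrow> 'g gring"
  is "\<lambda>\<zeta> a \<gamma>. if \<gamma> + \<gamma> < \<zeta> then a \<gamma> else 0"
  by (erule rev_finite_subset) auto

section \<open>Coxeter systems\<close>

definition wprod :: "('w, 'b) monoid_scheme \<Rightarrow> 'w list \<Rightarrow> 'w"
  where "wprod W ss = foldr (\<otimes>\<^bsub>W\<^esub>) ss \<one>\<^bsub>W\<^esub>"

text \<open>One step of rewriting with the defining relations \<open>(s t)^m(s,t) = 1\<close>, where \<open>m(s,t)\<close>
  is the order of \<open>s t\<close>; \<^const>\<open>group.ord\<close> is \<open>0\<close> for infinite order, which gives a
  trivial step. The case \<open>s = t\<close> gives \<open>s s = 1\<close>, so that no formal inverses are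
  needed in words.\<close>

inductive coxeter_step :: "('w, 'b) monoid_scheme \<Rightarrow> 'w set \<Rightarrow> 'w list \<Rightarrow> 'w list \<Rightarrow> bool"
  for W S
  where "\<lbrakk>s \<in> S; t \<in> S; set us \<subseteq> S; set vs \<subseteq> S\<rbrakk> \<Longrightarrow>
    coxeter_step W S (us @ concat (replicate (group.ord W (s \<otimes>\<^bsub>W\<^esub> t)) [s, t]) @ vs) (us @ vs)"

text \<open>The last assumption says that \<open>W\<close> is presented by the generators \<open>S\<close> and the
  relations \<open>(s t)^m(s,t) = 1\<close> with \<open>m(s,t)\<close> finite.\<close>

locale coxeter_system = group W
  for W :: "('w, 'b) monoid_scheme" (structure) +
  fixes S :: "'w set"
  assumes S_carrier: "S \<subseteq> carrier W"
    and S_generates: "generate W S = carrier W"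
    and S_involution: "s \<in> S \<Longrightarrow> ord s = 2"
    and presentation: "\<lbrakk>set us \<subseteq> S; set vs \<subseteq> S; wprod W us = wprod W vs\<rbrakk> \<Longrightarrow>
      equivclp (coxeter_step W S) us vs"

definition len :: "('w, 'b) monoid_scheme \<Rightarrow> 'w set \<Rightarrow> 'w \<Rightarrow> nat"
  where "len W S w = (LEAST n. \<exists>ss. set ss \<subseteq> S \<and> length ss = n \<and> wprod W ss = w)"

definition reduced_word :: "('w, 'b) monoid_scheme \<Rightarrow> 'w set \<Rightarrow> 'w list \<Rightarrow> bool"
  where "reduced_word W S ss \<longleftrightarrow> set ss \<subseteq> S \<and> length ss = len W S (wprod W ss)"

definition eps :: "('w, 'b) monoid_scheme \<Rightarrow> 'w set \<Rightarrow> 'w \<Rightarrow> 'g::ab_group_add gring"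
  where "eps W S w = (- 1) ^ len W S w"

definition reflections :: "('w, 'b) monoid_scheme \<Rightarrow> 'w set \<Rightarrow> 'w set"
  where "reflections W S = {w \<otimes>\<^bsub>W\<^esub> s \<otimes>\<^bsub>W\<^esub> inv\<^bsub>W\<^esub> w | w s. w \<in> carrier W \<and> s \<in> S}"

definition bruhat_step :: "('w, 'b) monoid_scheme \<Rightarrow> 'w set \<Rightarrow> 'w \<Rightarrow> 'w \<Rightarrow> bool"
  where "bruhat_step W S u v \<longleftrightarrow> u \<in> carrier W \<and> len W S u < len W S v \<and>
    (\<exists>t\<in>reflections W S. v = u \<otimes>\<^bsub>W\<^esub> t)"

definition bruhat_le :: "('w, 'b) monoid_scheme \<Rightarrow> 'w set \<Rightarrow> 'w \<Rightarrow> 'w \<Rightarrow> bool"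
  where "bruhat_le W S = (bruhat_step W S)\<^sup>*\<^sup>*"

definition bruhat_less :: "('w, 'b) monoid_scheme \<Rightarrow> 'w set \<Rightarrow> 'w \<Rightarrow> 'w \<Rightarrow> bool"
  where "bruhat_less W S u v \<longleftrightarrow> bruhat_le W S u v \<and> u \<noteq> v"

definition suffix_le :: "('w, 'b) monoid_scheme \<Rightarrow> 'w set \<Rightarrow> 'w \<Rightarrow> 'w \<Rightarrow> bool"
  where "suffix_le W S x y \<longleftrightarrow> x \<in> carrier W \<and>
    (\<exists>z\<in>carrier W. y = z \<otimes>\<^bsub>W\<^esub> x \<and> len W S y = len W S z + len W S x)"

definition D_set :: "('w, 'b) monoid_scheme \<Rightarrow> 'w set \<Rightarrow> 'w set \<Rightarrow> 'w set"
  where "D_set W S J = {w \<in> carrier W. \<forall>s\<in>J. len W S (w \<otimes>\<^bsub>W\<^esub> s) > len W S w}"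

locale weighted_coxeter_system = coxeter_system +
  fixes L :: "'a \<Rightarrow> 'g::linordered_ab_group_add"
  assumes weight_add: "reduced_word W S ss \<Longrightarrow> L (wprod W ss) = (\<Sum>s\<leftarrow>ss. L s)"
    and weight_nonneg: "s \<in> S \<Longrightarrow> 0 \<le> L s"

section \<open>Hecke algebras and \<open>W\<close>-graph ideals\<close>

definition is_basis ::
    "('a::comm_ring_1 \<Rightarrow> 'v::ab_group_add \<Rightarrow> 'v) \<Rightarrow> ('i \<Rightarrow> 'v) \<Rightarrow> 'i set \<Rightarrow> bool"
  where "is_basis scale B I \<longleftrightarrow> inj_on B I \<and> \<not> Modules.module.dependent scale (B ` I) \<and>
    Modules.module.span scale (B ` I) = UNIV"

text \<open>The Hecke algebra is the ring \<^typ>\<open>'h\<close> with scalar multiplication \<open>hscale\<close>, basis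
  \<open>T\<close> and bar involution \<open>hbar\<close>. These data are determined up to a unique isomorphism
  respecting the bases.\<close>

locale hecke_algebra = weighted_coxeter_system W S L + hmod: Modules.module hscale
  for W :: "('w, 'b) monoid_scheme" (structure)
    and S :: "'w set"
    and L :: "'w \<Rightarrow> 'g::linordered_ab_group_add"
    and hscale :: "'g gring \<Rightarrow> 'h::ring_1 \<Rightarrow> 'h" +
  fixes T :: "'w \<Rightarrow> 'h"
    and hbar :: "'h \<Rightarrow> 'h"
  assumes hscale_mult_left: "hscale a h * h' = hscale a (h * h')"
    and hscale_mult_right: "h * hscale a h' = hscale a (h * h')"
    and T_basis: "is_basis hscale T (carrier W)"
    and T_one: "T \<one> = 1"
    and T_mult_up: "\<lbrakk>s \<in> S; w \<in> carrier W; len W S (s \<otimes> w) > len W S w\<rbrakk> \<Longrightarrow>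
      T s * T w = T (s \<otimes> w)"
    and T_mult_down: "\<lbrakk>s \<in> S; w \<in> carrier W; len W S (s \<otimes> w) < len W S w\<rbrakk> \<Longrightarrow>
      T s * T w = hscale (q (L s)) (T (s \<otimes> w)) + hscale (q (L s) - 1) (T w)"
    and hbar_add: "hbar (h + h') = hbar h + hbar h'"
    and hbar_mult: "hbar (h * h') = hbar h * hbar h'"
    and hbar_one: "hbar 1 = 1"
    and hbar_scale: "hbar (hscale a h) = hscale (gbar a) (hbar h)"
    and hbar_hbar: "hbar (hbar h) = h"
    and hbar_T: "s \<in> S \<Longrightarrow>
      hbar (T s) = hscale (q (- L s)) (T s) + hscale (q (- L s) - 1) 1"

text \<open>\<open>E\<close> is the ideal for the suffix order, the type \<^typ>\<open>'m\<close> with \<open>mscale\<close> and \<open>act\<close> is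
  the Hecke module, \<open>G y\<close> is the basis element attached to \<open>y \<in> E\<close>, and \<open>mbar\<close> is
  the involution of the module. In \<open>act_WA\<close>, \<open>q (L s) dvd r z\<close> renders \<open>r z \<in> q\<^sub>s \<int>[\<Gamma>]\<close>;
  as \<open>q\<^sub>s\<close> is a unit, it holds automatically.\<close>

locale W_graph_ideal = hecke_algebra W S L hscale T hbar + mmod: Modules.module mscale
  for W :: "('w, 'b) monoid_scheme" (structure)
    and S :: "'w set"
    and L :: "'w \<Rightarrow> 'g::linordered_ab_group_add"
    and hscale :: "'g gring \<Rightarrow> 'h::ring_1 \<Rightarrow> 'h"
    and T :: "'w \<Rightarrow> 'h"
    and hbar :: "'h \<Rightarrow> 'h"
    and mscale :: "'g gring \<Rightarrow> 'm::ab_group_add \<Rightarrow> 'm" +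
  fixes E J :: "'w set"
    and act :: "'h \<Rightarrow> 'm \<Rightarrow> 'm"
    and G :: "'w \<Rightarrow> 'm"
    and mbar :: "'m \<Rightarrow> 'm"
  assumes E_carrier: "E \<subseteq> carrier W"
    and E_ideal: "\<lbrakk>y \<in> E; suffix_le W S x y\<rbrakk> \<Longrightarrow> x \<in> E"
    and J_subset: "J \<subseteq> {s \<in> S. \<forall>x\<in>E. len W S (x \<otimes> s) > len W S x}"
    and act_add_left: "act (h + h') m = act h m + act h' m"
    and act_add_right: "act h (m + m') = act h m + act h m'"
    and act_scale_left: "act (hscale a h) m = mscale a (act h m)"
    and act_scale_right: "act h (mscale a m) = mscale a (act h m)"
    and act_mult: "act (h * h') m = act h (act h' m)"
    and act_one: "act 1 m = m"
    and G_basis: "is_basis mscale G E"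
    and act_SD: "\<lbrakk>y \<in> E; s \<in> S; len W S (s \<otimes> y) < len W S y\<rbrakk> \<Longrightarrow>
      act (T s) (G y) = mscale (q (L s)) (G (s \<otimes> y)) + mscale (q (L s) - 1) (G y)"
    and act_SA: "\<lbrakk>y \<in> E; s \<in> S; len W S (s \<otimes> y) > len W S y; s \<otimes> y \<in> E\<rbrakk> \<Longrightarrow>
      act (T s) (G y) = G (s \<otimes> y)"
    and act_WD: "\<lbrakk>y \<in> E; s \<in> S; len W S (s \<otimes> y) > len W S y; s \<otimes> y \<notin> D_set W S J\<rbrakk> \<Longrightarrow>
      act (T s) (G y) = - G y"
    and act_WA: "\<lbrakk>y \<in> E; s \<in> S; len W S (s \<otimes> y) > len W S y; s \<otimes> y \<in> D_set W S J - E\<rbrakk> \<Longrightarrow>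
      \<exists>r. (\<forall>z. q (L s) dvd r z) \<and>
        act (T s) (G y) = mscale (q (L s)) (G y)
          - (\<Sum>z\<in>{z \<in> E. bruhat_less W S z (s \<otimes> y)}. mscale (r z) (G z))"
    and mbar_add: "mbar (m + m') = mbar m + mbar m'"
    and mbar_scale: "mbar (mscale a m) = mscale (gbar a) (mbar m)"
    and mbar_mbar: "mbar (mbar m) = m"
    and mbar_G_one: "mbar (G \<one>) = G \<one>"
    and mbar_act: "\<lbrakk>w \<in> carrier W; y \<in> E\<rbrakk> \<Longrightarrow>
      mbar (act (T w) (G y)) = act (hbar (T w)) (mbar (G y))"

section \<open>The polynomial families\<close>

text \<open>The coefficient of \<open>G x\<close> in the expansion of \<open>mbar (G y)\<close>, renormalised so that
  \<open>mbar (G y) = \<Sum>x. \<epsilon>\<^sub>x \<epsilon>\<^sub>y q\<^sub>y\<inverse> R\<^sub>x\<^sub>,\<^sub>y G x\<close>; see the lemma \<open>mbar_G\<close> below.\<close>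

definition R_poly :: "('w, 'b) monoid_scheme \<Rightarrow> 'w set \<Rightarrow> ('w \<Rightarrow> 'g::linordered_ab_group_add) \<Rightarrow>
    'w set \<Rightarrow> ('g gring \<Rightarrow> 'm::ab_group_add \<Rightarrow> 'm) \<Rightarrow> ('w \<Rightarrow> 'm) \<Rightarrow> ('m \<Rightarrow> 'm) \<Rightarrow>
    'w \<Rightarrow> 'w \<Rightarrow> 'g gring"
  where "R_poly W S L E mscale G mbar x y = eps W S x * eps W S y * q (L y) *
    Modules.module.representation mscale (G ` E) (mbar (G y)) (G x)"

definition dual_R :: "('w, 'b) monoid_scheme \<Rightarrow> 'w set \<Rightarrow> ('w \<Rightarrow> 'g::linordered_ab_group_add) \<Rightarrow>
    ('w \<Rightarrow> 'w \<Rightarrow> 'g gring) \<Rightarrow> 'w \<Rightarrow> 'w \<Rightarrow> 'g gring"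
  where "dual_R W S L R x y = eps W S x * eps W S y * q (- L x) * q (L y) * gbar (R x y)"

lemma eps_square [simp]: "eps W S x * eps W S x = 1"
  by (simp add: eps_def power_mult_distrib [symmetric])

lemma q_inverse [simp]: "q (- \<gamma>) * q \<gamma> = 1" "q \<gamma> * q (- \<gamma>) = 1" for \<gamma> :: "'g::ab_group_add"
  by (simp_all add: q_def mult_single)

lemma gbar_R_eq_dual_R:
  "gbar (R x y) = eps W S x * eps W S y * q (L x) * q (- L y) * dual_R W S L R x y"
proof -
  have "eps W S x * eps W S y * q (L x) * q (- L y) * dual_R W S L R x y
    = (eps W S x * eps W S x) * (eps W S y * eps W S y) * (q (L x) * q (- L x)) *
      (q (- L y) * q (L y)) * gbar (R x y)"
    unfolding dual_R_def by (simp only: ac_simps)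
  then show ?thesis by simp
qed

lemma (in W_graph_ideal) mbar_G:
  fixes y
  defines "R \<equiv> R_poly W S L E mscale G mbar"
  shows "finite {x \<in> E. R x y \<noteq> 0}"
    and "mbar (G y) =
      (\<Sum>x\<in>{x \<in> E. R x y \<noteq> 0}. mscale (eps W S x * eps W S y * q (- L y) * R x y) (G x))"
proof -
  let ?c = "mmod.representation (G ` E) (mbar (G y))"
  have inj: "inj_on G E" and ind: "mmod.independent (G ` E)" and span: "mmod.span (G ` E) = UNIV"
    using G_basis by (auto simp: is_basis_def)
  have c: "eps W S x * eps W S y * q (- L y) * R x y = ?c (G x)" for x
  proof -
    have "eps W S x * eps W S y * q (- L y) * R x y = (eps W S x * eps W S x) *
      (eps W S y * eps W S y) * (q (- L y) * q (L y)) * ?c (G x)"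
      unfolding R_def R_poly_def by (simp only: ac_simps)
    then show ?thesis by simp
  qed
  have nz: "R x y \<noteq> 0 \<longleftrightarrow> ?c (G x) \<noteq> 0" for x
    using c[of x] by (metis R_def R_poly_def mult_zero_right)
  have im: "G ` {x \<in> E. R x y \<noteq> 0} = {b. ?c b \<noteq> 0}"
    using mmod.representation_ne_zero by (force simp: nz)
  have inj': "inj_on G {x \<in> E. R x y \<noteq> 0}"
    by (rule inj_on_subset[OF inj]) auto
  show "finite {x \<in> E. R x y \<noteq> 0}"
    using finite_imageD[OF _ inj'] mmod.finite_representation im by metis
  have "mbar (G y) = (\<Sum>b | ?c b \<noteq> 0. mscale (?c b) b)"
    using mmod.sum_nonzero_representation_eq[OF ind] span by auto
  also have "\<dots> = (\<Sum>x\<in>{x \<in> E. R x y \<noteq> 0}. mscale (?c (G x)) (G x))"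
    unfolding im[symmetric] by (simp add: sum.reindex[OF inj'])
  finally show "mbar (G y) =
      (\<Sum>x\<in>{x \<in> E. R x y \<noteq> 0}. mscale (eps W S x * eps W S y * q (- L y) * R x y) (G x))"
    by (simp only: c)
qed

text \<open>Index set \<open>{t \<in> E. x \<le> t \<le> y}\<close> of the sums below; it is finite since Bruhat intervals
  are finite.\<close>

definition E_interval :: "('w, 'b) monoid_scheme \<Rightarrow> 'w set \<Rightarrow> 'w set \<Rightarrow> 'w \<Rightarrow> 'w \<Rightarrow> 'w set"
  where "E_interval W S E x y = {t \<in> E. bruhat_le W S x t \<and> bruhat_le W S t y}"

definition is_KL_family :: "('w, 'b) monoid_scheme \<Rightarrow> 'w set \<Rightarrow>
    ('w \<Rightarrow> 'g::linordered_ab_group_add) \<Rightarrow> 'w set \<Rightarrow> ('w \<Rightarrow> 'w \<Rightarrow> 'g gring) \<Rightarrow>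
    ('w \<Rightarrow> 'w \<Rightarrow> 'g gring) \<Rightarrow> bool"
  where "is_KL_family W S L E R P \<longleftrightarrow> (\<forall>x\<in>E. \<forall>y\<in>E.
    (\<not> bruhat_le W S x y \<longrightarrow> P x y = 0) \<and>
    (x = y \<longrightarrow> P x y = 1) \<and>
    (bruhat_less W S x y \<longrightarrow> deg_less_half (P x y) (L y - L x)) \<and>
    q (- L x) * q (L y) * gbar (P x y) = (\<Sum>t\<in>E_interval W S E x y. R x t * P t y))"

definition is_inverse_KL_family :: "('w, 'b) monoid_scheme \<Rightarrow> 'w set \<Rightarrow> 'w set \<Rightarrow>
    ('w \<Rightarrow> 'w \<Rightarrow> 'g::linordered_ab_group_add gring) \<Rightarrow> ('w \<Rightarrow> 'w \<Rightarrow> 'g gring) \<Rightarrow> bool"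
  where "is_inverse_KL_family W S E P Q \<longleftrightarrow> (\<forall>x\<in>E. \<forall>y\<in>E.
    (\<not> bruhat_le W S x y \<longrightarrow> Q x y = 0) \<and>
    (\<Sum>t\<in>E_interval W S E x y. eps W S t * eps W S y * Q x t * P t y) = (if x = y then 1 else 0))"

section \<open>Chains and the polynomials attached to them\<close>

text \<open>A (multi)chain \<open>x\<^sub>0, \<dots>, x\<^sub>k\<^sub>+\<^sub>1\<close> is the list of its \<open>k + 2\<close> entries.\<close>

definition chains_k ::
    "('w, 'b) monoid_scheme \<Rightarrow> 'w set \<Rightarrow> 'w set \<Rightarrow> nat \<Rightarrow> 'w \<Rightarrow> 'w \<Rightarrow> 'w list set"
  where "chains_k W S E k x y = {xs. length xs = k + 2 \<and> hd xs = x \<and> last xs = y \<and>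
    set xs \<subseteq> E \<and> successively (bruhat_less W S) xs}"

definition multichains_k ::
    "('w, 'b) monoid_scheme \<Rightarrow> 'w set \<Rightarrow> 'w set \<Rightarrow> nat \<Rightarrow> 'w \<Rightarrow> 'w \<Rightarrow> 'w list set"
  where "multichains_k W S E k x y = {xs. length xs = k + 2 \<and> hd xs = x \<and> last xs = y \<and>
    set xs \<subseteq> E \<and> successively (bruhat_le W S) xs}"

definition E_chains :: "('w, 'b) monoid_scheme \<Rightarrow> 'w set \<Rightarrow> 'w set \<Rightarrow> 'w \<Rightarrow> 'w \<Rightarrow> 'w list set"
  where "E_chains W S E x y = (\<Union>k. chains_k W S E k x y)"

definition E_multichains :: "('w, 'b) monoid_scheme \<Rightarrow> 'w set \<Rightarrow> 'w set \<Rightarrow> 'w \<Rightarrow> 'w \<Rightarrow> 'w list set"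
  where "E_multichains W S E x y = (\<Union>k. multichains_k W S E k x y)"

text \<open>\<open>rstar_rev L Rt\<close> takes the multichain in reverse order, \<open>[x\<^sub>r\<^sub>+\<^sub>1, x\<^sub>r, \<dots>, x\<^sub>0]\<close>, so that the
  recursion, which deletes the last entry of the multichain, is structural. \<open>Rt\<close> is
  the family of dual \<open>R\<close>-polynomials. The values at lists with fewer than two entries,
  which are not multichains, are irrelevant.\<close>

definition rstar2 :: "('w \<Rightarrow> 'g::linordered_ab_group_add) \<Rightarrow> ('w \<Rightarrow> 'w \<Rightarrow> 'g gring) \<Rightarrow>
    'w \<Rightarrow> 'w \<Rightarrow> 'g gring"
  where "rstar2 L Rt x y = q (- L x) * q (L y) * gbar (Rt x y)"

fun rstar_rev :: "('w \<Rightarrow> 'g::linordered_ab_group_add) \<Rightarrow> ('w \<Rightarrow> 'w \<Rightarrow> 'g gring) \<Rightarrow>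
    'w list \<Rightarrow> 'g gring"
  where
    "rstar_rev L Rt [] = 0"
  | "rstar_rev L Rt [x] = 0"
  | "rstar_rev L Rt [y, x] = rstar2 L Rt x y"
  | "rstar_rev L Rt (y # z # w # us) =
      (let x = last (w # us) in
        U_half (L z - L x) (q (- L x) * q (L z) * gbar (rstar_rev L Rt (z # w # us))) *
        rstar2 L Rt z y)"

definition rstar :: "('w \<Rightarrow> 'g::linordered_ab_group_add) \<Rightarrow> ('w \<Rightarrow> 'w \<Rightarrow> 'g gring) \<Rightarrow>
    'w list \<Rightarrow> 'g gring"
  where "rstar L Rt xs = rstar_rev L Rt (rev xs)"

end

(* Put sP x y = eps_x eps_y P x y and sR x y = eps_x eps_y R x y, and let F^ denote the family with
   entries q_x^-1 q_y bar(F x y). In the incidence algebra of E the recursions read Q * sP = 1 and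
   sP^ = sR * sP, hence Q^ * sR = Q, since sP is unitriangular. As Q x t has degree < (L t - L x) / 2,
   truncating Q x y = sum_t (Q^ x t) (sR t y) gives a recursion for Q x y in terms of the Q x t with
   t < y, which is the recursion satisfied by the truncated sums over chains, split by the
   penultimate entry. A repeated entry anywhere but in last position makes the R~*-polynomial of a
   multichain vanish, and the repetition of the last entry contributes the missing term Q^ x y.

   Bruhat intervals are finite because of the strong exchange property, for which the presentation
   of W enters as follows: each relator (s t)^m lists every reflection an even number of times. *)
theory Submission
  imports Defs "HOL-Library.Sublist"
begin

section \<open>Strong exchange and finiteness of Bruhat intervals\<close>

text \<open>For a word in involutions, right multiplication of its product by the i-th entry deletes
  the i-th letter. The parity with which a reflection is listed will turn out to depend only on the
  product of the word; it is the reflection cocycle of a Coxeter group.\<close>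

fun right_refs :: "('w, 'b) monoid_scheme \<Rightarrow> 'w list \<Rightarrow> 'w list"
  where
    "right_refs W [] = []"
  | "right_refs W (s # ss) = (inv\<^bsub>W\<^esub> (wprod W ss) \<otimes>\<^bsub>W\<^esub> s \<otimes>\<^bsub>W\<^esub> wprod W ss) # right_refs W ss"

lemma wprod_Nil [simp]: "wprod W [] = \<one>\<^bsub>W\<^esub>"
  and wprod_Cons [simp]: "wprod W (s # ss) = s \<otimes>\<^bsub>W\<^esub> wprod W ss"
  by (simp_all add: wprod_def)

section \<open>Reflections listed by a word in a group\<close>

context group
begin

lemma inv_mult_cancel_left [simp]:
  "\<lbrakk>a \<in> carrier G; b \<in> carrier G\<rbrakk> \<Longrightarrow> inv a \<otimes> (a \<otimes> b) = b"
  "\<lbrakk>a \<in> carrier G; b \<in> carrier G\<rbrakk> \<Longrightarrow> a \<otimes> (inv a \<otimes> b) = b"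
  by (simp_all add: m_assoc [symmetric])

lemma wprod_closed [simp]: "set ss \<subseteq> carrier G \<Longrightarrow> wprod G ss \<in> carrier G"
  by (induction ss) auto

lemma wprod_append [simp]:
  "\<lbrakk>set us \<subseteq> carrier G; set vs \<subseteq> carrier G\<rbrakk> \<Longrightarrow> wprod G (us @ vs) = wprod G us \<otimes> wprod G vs"
  by (induction us) (auto simp: m_assoc)

lemma right_refs_closed: "set ss \<subseteq> carrier G \<Longrightarrow> set (right_refs G ss) \<subseteq> carrier G"
  by (induction ss) auto

lemma right_refs_append:
  "\<lbrakk>set us \<subseteq> carrier G; set vs \<subseteq> carrier G\<rbrakk> \<Longrightarrow> right_refs G (us @ vs) =
    map (\<lambda>t. inv (wprod G vs) \<otimes> t \<otimes> wprod G vs) (right_refs G us) @ right_refs G vs"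
  by (induction us) (auto simp: m_assoc inv_mult_group)

lemma count_list_conj:
  assumes "set ts \<subseteq> carrier G" "g \<in> carrier G" "t \<in> carrier G"
  shows "count_list (map (\<lambda>t. inv g \<otimes> t \<otimes> g) ts) t = count_list ts (g \<otimes> t \<otimes> inv g)"
proof -
  have "inv g \<otimes> a \<otimes> g = t \<longleftrightarrow> a = g \<otimes> t \<otimes> inv g" if "a \<in> carrier G" for a
    using that assms by (auto simp: m_assoc)
  with assms(1) show ?thesis by (induction ts) auto
qed

text \<open>The cocycle rule: the letters of \<open>us\<close> see \<open>vs\<close> as an
  additional suffix, which conjugates their reflections, and conjugation is injective.\<close>

lemma count_right_refs_append:
  assumes "set us \<subseteq> carrier G" "set vs \<subseteq> carrier G" "t \<in> carrier G"
  shows "count_list (right_refs G (us @ vs)) t =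
    count_list (right_refs G us) (wprod G vs \<otimes> t \<otimes> inv (wprod G vs)) + count_list (right_refs G vs) t"
proof -
  have "count_list (map (\<lambda>t. inv (wprod G vs) \<otimes> t \<otimes> wprod G vs) (right_refs G us)) t =
      count_list (right_refs G us) (wprod G vs \<otimes> t \<otimes> inv (wprod G vs))"
    using assms by (intro count_list_conj right_refs_closed wprod_closed)
  then show ?thesis
    unfolding right_refs_append[OF assms(1,2)] count_list_append by (rule arg_cong)
qed

text \<open>If \<open>t\<close> comes from the letter \<open>s\<close>, then in
  \<open>wprod G ss \<otimes> t\<close> the suffix behind \<open>s\<close> cancels against its
  inverse and the two copies of \<open>s\<close> cancel. The letters in front of \<open>s\<close>
  are kept.\<close>

lemma right_refs_deletion:
  assumes "set ss \<subseteq> carrier G" "\<And>s. s \<in> set ss \<Longrightarrow> s \<otimes> s = \<one>" "t \<in> set (right_refs G ss)"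
  shows "\<exists>ss'. subseq ss' ss \<and> length ss' < length ss \<and> wprod G ss' = wprod G ss \<otimes> t"
  using assms
proof (induction ss)
  case (Cons s ss)
  show ?case
  proof (cases "t \<in> set (right_refs G ss)")
    case True
    with Cons obtain ss' where "subseq ss' ss" "length ss' < length ss" "wprod G ss' = wprod G ss \<otimes> t"
      by auto
    moreover have "t \<in> carrier G"
      using True right_refs_closed[of ss] Cons.prems by auto
    ultimately show ?thesis
      using Cons.prems by (intro exI[of _ "s # ss'"]) (auto simp: m_assoc)
  next
    case False
    with Cons.prems have t: "t = inv (wprod G ss) \<otimes> s \<otimes> wprod G ss" by auto
    have "wprod G (s # ss) \<otimes> t = (s \<otimes> s) \<otimes> wprod G ss"
      unfolding t using Cons.prems(1) by (simp add: m_assoc)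
    also have "\<dots> = wprod G ss" using Cons.prems by simp
    finally show ?thesis by (intro exI[of _ ss]) auto
  qed
qed simp

end

lemma set_mono_subseq: "subseq xs ys \<Longrightarrow> set xs \<subseteq> set ys"
  by (induction rule: list_emb.induct) auto

lemma set_concat_replicate: "set (concat (replicate k xs)) \<subseteq> set xs"
  by (induction k) auto

lemma upt_double: "[0..<2 * m] = [0..<m] @ map (\<lambda>i. i + m) [0..<m]"
  unfolding map_add_upt mult_2 by (rule upt_add_eq_append) simp

section \<open>Words in a Coxeter system and parities of reflections\<close>

context coxeter_system
begin

lemma S_closed [simp]: "s \<in> S \<Longrightarrow> s \<in> carrier W"
  using S_carrier by auto

lemma word_closed [simp]: "set ss \<subseteq> S \<Longrightarrow> set ss \<subseteq> carrier W"
  using S_carrier by auto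

lemma S_square: "s \<in> S \<Longrightarrow> s \<otimes> s = \<one>"
  using pow_ord_eq_1[of s] S_involution[of s] by (simp add: numeral_2_eq_2)

lemma S_inv: "s \<in> S \<Longrightarrow> inv s = s"
  by (simp add: S_square inv_equality)

lemma wprod_rev: "set ss \<subseteq> S \<Longrightarrow> wprod W (rev ss) = inv (wprod W ss)"
proof (induction ss)
  case (Cons s ss)
  then show ?case by (simp add: inv_mult_group S_inv[of s])
qed simp

lemma ex_word:
  assumes "w \<in> carrier W"
  shows "\<exists>ss. set ss \<subseteq> S \<and> wprod W ss = w"
proof -
  have "w \<in> generate W S" using assms S_generates by simp
  then show ?thesis
  proof induction
    case one
    show ?case by (rule exI[of _ "[]"]) simp
  next
    case (incl h)
    then show ?case by (intro exI[of _ "[h]"]) simp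
  next
    case (inv h)
    then show ?case by (intro exI[of _ "[h]"]) (simp add: S_inv)
  next
    case (eng g h)
    then obtain us vs where "set us \<subseteq> S" "wprod W us = g" "set vs \<subseteq> S" "wprod W vs = h" by auto
    then show ?case by (intro exI[of _ "us @ vs"]) simp
  qed
qed

lemma ex_reduced_word:
  assumes "w \<in> carrier W"
  shows "\<exists>ss. set ss \<subseteq> S \<and> wprod W ss = w \<and> length ss = len W S w"
proof -
  have "\<exists>n ss. set ss \<subseteq> S \<and> length ss = n \<and> wprod W ss = w" using ex_word[OF assms] by auto
  from LeastI_ex[OF this] show ?thesis unfolding len_def by auto
qed

lemma len_le: "set ss \<subseteq> S \<Longrightarrow> len W S (wprod W ss) \<le> length ss"
  unfolding len_def by (rule Least_le) auto

lemma wprod_replicate: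
  "\<lbrakk>s \<in> S; t \<in> S\<rbrakk> \<Longrightarrow> wprod W (concat (replicate k [s, t])) = (s \<otimes> t) [^] k"
proof (induction k)
  case (Suc k)
  then have "wprod W (concat (replicate (Suc k) [s, t])) = (s \<otimes> t) \<otimes> (s \<otimes> t) [^] k"
    by (simp add: m_assoc)
  also have "\<dots> = (s \<otimes> t) [^] Suc k"
    using nat_pow_Suc2[of "s \<otimes> t" k] Suc.prems by simp
  finally show ?case .
qed simp

lemma dihedral_pow:
  assumes "s \<in> S" "t \<in> S"
  shows "inv ((s \<otimes> t) [^] k) = (t \<otimes> s) [^] (k::nat)" "t \<otimes> (s \<otimes> t) [^] k = (t \<otimes> s) [^] k \<otimes> t"
proof -
  show "inv ((s \<otimes> t) [^] k) = (t \<otimes> s) [^] k"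
    using assms by (simp add: nat_pow_inv[symmetric] inv_mult_group S_inv)
  show "t \<otimes> (s \<otimes> t) [^] k = (t \<otimes> s) [^] k \<otimes> t"
  proof (induction k)
    case (Suc k)
    have "t \<otimes> (s \<otimes> t) [^] Suc k = (t \<otimes> (s \<otimes> t) [^] k) \<otimes> (s \<otimes> t)"
      using assms by (simp add: m_assoc)
    also have "\<dots> = (t \<otimes> s) [^] Suc k \<otimes> t"
      unfolding Suc using assms by (simp add: m_assoc)
    finally show ?case .
  qed (use assms in simp)
qed

text \<open>The exponent \<open>i\<close> counts letters from the right end of the word;
  \<open>rev\<close> appears because \<open>right_refs\<close> begins with the first letter, which
  has the longest suffix.\<close>

lemma right_refs_replicate:
  assumes "s \<in> S" "t \<in> S"
  shows "right_refs W (concat (replicate k [s, t])) =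
    rev (map (\<lambda>i. (t \<otimes> s) [^] i \<otimes> t) [0..<2 * k])"
proof (induction k)
  case (Suc k)
  let ?p = "(s \<otimes> t) [^] k" and ?r = "(t \<otimes> s) [^] k"
  \<comment> \<open>The two letters put in front of the word contribute the exponents
    \<open>2 * k\<close> and \<open>2 * k + 1\<close>.\<close>
  have 1: "inv ?p \<otimes> t \<otimes> ?p = (t \<otimes> s) [^] (2 * k) \<otimes> t"
    using assms by (simp add: dihedral_pow m_assoc mult_2 nat_pow_mult[symmetric])
  have "inv (t \<otimes> ?p) \<otimes> s \<otimes> (t \<otimes> ?p) = ?r \<otimes> (t \<otimes> s) \<otimes> (?r \<otimes> t)"
    using assms by (simp add: inv_mult_group S_inv dihedral_pow m_assoc)
  also have "\<dots> = (t \<otimes> s) [^] Suc (2 * k) \<otimes> t"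
  proof -
    have "(t \<otimes> s) [^] Suc (2 * k) = ?r \<otimes> (t \<otimes> s) \<otimes> ?r"
      using nat_pow_mult[of "t \<otimes> s" "Suc k" k] assms by (simp add: mult_2)
    then show ?thesis using assms by (simp add: m_assoc)
  qed
  finally show ?case using Suc 1 assms
    by (simp add: wprod_replicate)
qed simp

text \<open>Since \<open>(t \<otimes> s) [^] m = \<one>\<close> for the order \<open>m\<close>, the
  exponents \<open>i\<close> and \<open>i + m\<close> give the same reflection, so the list is some
  list written twice. For infinite order the word is empty.\<close>

lemma even_count_braid:
  assumes "s \<in> S" "t \<in> S"
  shows "even (count_list (right_refs W (concat (replicate (ord (s \<otimes> t)) [s, t]))) r)"
proof -
  let ?m = "ord (s \<otimes> t)" and ?f = "\<lambda>i::nat. (t \<otimes> s) [^] i \<otimes> t"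
  have ord: "(t \<otimes> s) [^] ?m = \<one>"
    using assms by (simp flip: dihedral_pow(1))
  have "?f (i + ?m) = ?f i" for i
    using assms by (simp add: ord flip: nat_pow_mult)
  then have "map ?f [0..<2 * ?m] = map ?f [0..<?m] @ map ?f [0..<?m]"
    by (simp add: upt_double)
  then show ?thesis unfolding right_refs_replicate[OF assms] by simp
qed

text \<open>Here the presentation enters. A relator has product \<open>\<one>\<close>, so removing
  it does not change how the letters to its left are conjugated, and it lists every reflection an
  even number of times.\<close>

lemma even_count_cong:
  assumes "set us \<subseteq> S" "set vs \<subseteq> S" "wprod W us = wprod W vs" "t \<in> carrier W"
  shows "even (count_list (right_refs W us) t) = even (count_list (right_refs W vs) t)"
proof -
  have step: "even (count_list (right_refs W as) t) = even (count_list (right_refs W bs) t)"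
    if "coxeter_step W S as bs" for as bs
    using that
  proof cases
    case (1 s t' ys zs)
    let ?b = "concat (replicate (ord (s \<otimes> t')) [s, t'])"
    have b: "set ?b \<subseteq> S" using set_concat_replicate[of _ "[s, t']"] 1 by fastforce
    have "wprod W ?b = \<one>" using 1 by (simp add: wprod_replicate)
    with 1 b assms(4) show ?thesis
      by (simp add: count_right_refs_append even_count_braid m_assoc)
  qed
  from presentation[OF assms(1-3)] show ?thesis
    by induction (use step in auto)
qed

lemma reflection_closed: "t \<in> reflections W S \<Longrightarrow> t \<in> carrier W"
  by (auto simp: reflections_def)

lemma reflection_square: "t \<in> reflections W S \<Longrightarrow> t \<otimes> t = \<one>"
proof -
  assume "t \<in> reflections W S"
  then obtain w s where ws: "w \<in> carrier W" "s \<in> S" "t = w \<otimes> s \<otimes> inv w" by (auto simp: reflections_def)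
  then have "t \<otimes> t = w \<otimes> (s \<otimes> s) \<otimes> inv w"
    by (simp add: m_assoc)
  with ws show ?thesis by (simp add: S_square)
qed

text \<open>By parity invariance, \<open>ts\<close> may be replaced with the palindrome
  \<open>us\<close>, \<open>s\<close>, \<open>rev us\<close>, where \<open>us\<close> is a word for
  \<open>w\<close> and \<open>t = w \<otimes> s \<otimes> inv w\<close>. Compared with
  \<open>us\<close>, \<open>rev us\<close>, a word for \<open>\<one>\<close> with even count, the
  middle letter adds exactly one occurrence of \<open>t\<close>.\<close>

lemma odd_count_reflection:
  assumes "t \<in> reflections W S" "set ts \<subseteq> S" "wprod W ts = t"
  shows "odd (count_list (right_refs W ts) t)"
proof -
  obtain w s where ws: "w \<in> carrier W" "s \<in> S" and t: "t = w \<otimes> s \<otimes> inv w"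
    using assms(1) by (auto simp: reflections_def)
  obtain us where us: "set us \<subseteq> S" "wprod W us = w" using ex_word ws by blast
  have "even (count_list (right_refs W ts) t) =
      even (count_list (right_refs W ((us @ [s]) @ rev us)) t)"
    using assms us ws t by (intro even_count_cong) (simp_all add: wprod_rev m_assoc)
  moreover have "count_list (right_refs W ((us @ [s]) @ rev us)) t =
      count_list (right_refs W us) s + 1 + count_list (right_refs W (rev us)) t"
  proof -
    have 1: "inv w \<otimes> t \<otimes> w = s" using ws by (simp add: t m_assoc)
    have 2: "s \<otimes> s \<otimes> inv s = s" using ws by (simp add: m_assoc)
    show ?thesis
      using us ws 1 2
      by (subst count_right_refs_append) (auto simp: count_right_refs_append wprod_rev t)
  qed
  moreover have "even (count_list (right_refs W (us @ rev us)) t) = even (count_list (right_refs W []) t)"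
    using us ws t by (intro even_count_cong) (simp_all add: wprod_rev)
  moreover have "count_list (right_refs W (us @ rev us)) t =
      count_list (right_refs W us) s + count_list (right_refs W (rev us)) t"
    using us ws by (subst count_right_refs_append) (auto simp: wprod_rev t m_assoc)
  ultimately show ?thesis by auto
qed

text \<open>The reflection \<open>t\<close> with \<open>v = u \<otimes> t\<close> has odd count in
  one word for \<open>v\<close>, hence in every word for \<open>v\<close>, reduced or not. So
  \<open>t\<close> is listed by \<open>ss\<close>, and deleting the corresponding letter gives
  \<open>v \<otimes> t = u\<close>.\<close>

lemma strong_exchange:
  assumes "bruhat_step W S u v" "set ss \<subseteq> S" "wprod W ss = v"
  shows "\<exists>ss'. subseq ss' ss \<and> wprod W ss' = u"
proof -
  obtain t where u: "u \<in> carrier W" "len W S u < len W S v" and t: "t \<in> reflections W S" "v = u \<otimes> t"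
    using assms(1) by (auto simp: bruhat_step_def)
  note tc = reflection_closed[OF t(1)] and tt = reflection_square[OF t(1)]
  have sq: "s \<otimes> s = \<one>" if "s \<in> set xs" "set xs \<subseteq> S" for s xs using that S_square by auto
  obtain us where us: "set us \<subseteq> S" "wprod W us = u" "length us = len W S u"
    using ex_reduced_word u by blast
  obtain ts where ts: "set ts \<subseteq> S" "wprod W ts = t" using ex_word tc by blast
  \<comment> \<open>Otherwise a deletion in the reduced word \<open>us\<close> would make
    \<open>v\<close> shorter than \<open>u\<close>.\<close>
  have "t \<notin> set (right_refs W us)"
  proof
    assume "t \<in> set (right_refs W us)"
    then obtain us' where us': "subseq us' us" "length us' < length us" "wprod W us' = u \<otimes> t"
      using right_refs_deletion[of us t] sq us by auto
    then have "set us' \<subseteq> S" using us(1) set_mono_subseq[OF us'(1)] by auto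
    from len_le[OF this] us' us u t show False by simp
  qed
  \<comment> \<open>Conjugation by \<open>t\<close> fixes \<open>t\<close>, so \<open>us\<close>
    contributes nothing and \<open>ts\<close> an odd number.\<close>
  then have "odd (count_list (right_refs W (us @ ts)) t)"
    using us ts tc tt odd_count_reflection[OF t(1) ts]
    by (subst count_right_refs_append) (simp_all add: inv_equality count_list_0_iff)
  moreover have "even (count_list (right_refs W ss) t) = even (count_list (right_refs W (us @ ts)) t)"
    using us ts assms t tc by (intro even_count_cong) auto
  ultimately have "count_list (right_refs W ss) t \<noteq> 0"
    by (metis even_zero)
  then have "t \<in> set (right_refs W ss)"
    by (simp add: count_list_0_iff)
  then obtain ss' where "subseq ss' ss" "wprod W ss' = v \<otimes> t"
    using right_refs_deletion[of ss t] sq assms by auto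
  moreover have "v \<otimes> t = u" using t u tc tt by (simp add: m_assoc)
  ultimately show ?thesis by auto
qed

text \<open>One deletion for each Bruhat step. The intermediate subwords need not be reduced, so
  exchange is needed for arbitrary words.\<close>

lemma bruhat_le_subword:
  assumes "bruhat_le W S u v" "set ss \<subseteq> S" "wprod W ss = v"
  shows "\<exists>ss'. subseq ss' ss \<and> wprod W ss' = u"
  using assms(1) unfolding bruhat_le_def
proof (induction rule: converse_rtranclp_induct)
  case base
  show ?case using assms by auto
next
  case (step y z)
  then obtain ss' where ss': "subseq ss' ss" "wprod W ss' = z" by auto
  then have "set ss' \<subseteq> S" using assms set_mono_subseq[OF ss'(1)] by auto
  from strong_exchange[OF step(1) this ss'(2)] ss'(1) show ?case
    using subseq_order.order_trans by blast
qed

lemma finite_bruhat_le: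
  assumes "v \<in> carrier W"
  shows "finite {u. bruhat_le W S u v}"
proof -
  obtain ss where ss: "set ss \<subseteq> S" "wprod W ss = v" using ex_word assms by blast
  have "{u. bruhat_le W S u v} \<subseteq> wprod W ` set (subseqs ss)"
    using bruhat_le_subword[OF _ ss] by (fastforce simp: image_iff)
  then show ?thesis using finite_surj[OF finite_set] by blast
qed

end

section \<open>The Bruhat order as a partial order\<close>

lemma bruhat_le_refl [simp]: "bruhat_le W S x x"
  by (simp add: bruhat_le_def)

lemma bruhat_le_trans: "\<lbrakk>bruhat_le W S x y; bruhat_le W S y z\<rbrakk> \<Longrightarrow> bruhat_le W S x z"
  by (simp add: bruhat_le_def)

lemma bruhat_less_len: "bruhat_less W S x y \<Longrightarrow> len W S x < len W S y"
proof -
  have "x = y \<or> len W S x < len W S y" if "bruhat_le W S x y"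
    using that unfolding bruhat_le_def
    by induction (auto simp: bruhat_step_def)
  then show "bruhat_less W S x y \<Longrightarrow> len W S x < len W S y" by (auto simp: bruhat_less_def)
qed

lemma bruhat_le_antisym: "\<lbrakk>bruhat_le W S x y; bruhat_le W S y x\<rbrakk> \<Longrightarrow> x = y"
  using bruhat_less_len[of W S x y] bruhat_less_len[of W S y x] by (force simp: bruhat_less_def)

lemma bruhat_less_trans: "\<lbrakk>bruhat_less W S x y; bruhat_less W S y z\<rbrakk> \<Longrightarrow> bruhat_less W S x z"
  by (metis bruhat_le_antisym bruhat_le_trans bruhat_less_def)

lemma E_interval_refl: "x \<in> E \<Longrightarrow> E_interval W S E x x = {x}"
  by (auto simp: E_interval_def dest: bruhat_le_antisym)

section \<open>Bar and truncations on the group ring\<close>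

lemma lookup_q_mult: "Poly_Mapping.lookup (q c * f) \<gamma> = Poly_Mapping.lookup f (\<gamma> - c)"
  for c :: "'g::ab_group_add"
proof -
  have "Poly_Mapping.lookup (q c * f) \<gamma> =
      (\<Sum>a. (\<Sum>l. (Poly_Mapping.lookup f l when \<gamma> = c + l)) when a = c)"
    unfolding lookup_mult by (rule Sum_any.cong) (auto simp: q_def lookup_single when_def)
  also have "\<dots> = (\<Sum>l. (Poly_Mapping.lookup f l when \<gamma> = c + l))"
    by simp
  also have "\<dots> = (\<Sum>l. (Poly_Mapping.lookup f l when l = \<gamma> - c))"
    by (rule Sum_any.cong) (auto simp: algebra_simps when_def)
  finally show ?thesis by simp
qed

section \<open>The bar as a ring involution\<close>

lemma gbar_add: "gbar (f + g) = gbar f + gbar g"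
  by (rule poly_mapping_eqI) (simp add: lookup_gbar lookup_add)

lemma gbar_zero [simp]: "gbar 0 = 0"
  by (rule poly_mapping_eqI) (simp add: lookup_gbar)

lemma gbar_uminus: "gbar (- f) = - gbar f"
  by (rule poly_mapping_eqI) (simp add: lookup_gbar)

lemma gbar_single: "gbar (Poly_Mapping.single a b) = Poly_Mapping.single (- a) b"
proof -
  have "a = - \<gamma> \<longleftrightarrow> - a = \<gamma>" for \<gamma> by auto
  then show ?thesis by (intro poly_mapping_eqI) (simp add: lookup_gbar lookup_single)
qed

lemma gbar_one [simp]: "gbar 1 = 1"
  unfolding single_one [symmetric] gbar_single by simp

lemma gbar_gbar [simp]: "gbar (gbar f) = f"
  by (rule poly_mapping_eqI) (simp add: lookup_gbar)

lemma gbar_q [simp]: "gbar (q \<gamma>) = q (- \<gamma>)"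
  by (simp add: q_def gbar_single)

text \<open>Turns the step of \<open>update_induct\<close> into the addition of a monomial, so that
  multiplicativity of the bar reduces to monomials.\<close>

lemma update_eq_add_single:
  "a \<notin> Poly_Mapping.keys f \<Longrightarrow> Poly_Mapping.update a b f = f + Poly_Mapping.single a b"
  by (rule poly_mapping_eqI) (auto simp: lookup_update lookup_add lookup_single when_def in_keys_iff)

lemma gbar_mult: "gbar (f * g) = gbar f * gbar g"
proof -
  have single: "gbar (Poly_Mapping.single a b * g) = gbar (Poly_Mapping.single a b) * gbar g" for a b
    by (induction g rule: update_induct)
      (simp_all add: update_eq_add_single distrib_left gbar_add gbar_single mult_single)
  show ?thesis
    by (induction f rule: update_induct)
      (simp_all add: update_eq_add_single distrib_right gbar_add single)
qed

lemma gbar_sum: "gbar (sum f A) = (\<Sum>a\<in>A. gbar (f a))"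
  by (induction A rule: infinite_finite_induct) (simp_all add: gbar_add)

lemma gbar_eps [simp]: "gbar (eps W S w) = eps W S w"
proof -
  have "gbar ((- 1) ^ n) = (- 1) ^ n" for n
    by (induction n) (simp_all add: gbar_mult gbar_uminus)
  then show ?thesis by (simp add: eps_def)
qed

text \<open>For \<zeta> = \<open>L y - L x\<close> this is the hat operation on the entry at
  \<open>x\<close>, \<open>y\<close> of a family. It reflects exponents in \<zeta>/2 and so
  exchanges the parts below and above this point.\<close>

definition twist :: "'g::ab_group_add \<Rightarrow> 'g gring \<Rightarrow> 'g gring"
  where "twist \<zeta> f = q \<zeta> * gbar f"

lemma q_add: "q (\<gamma> + \<zeta>) = q \<gamma> * q \<zeta>"
  by (simp add: q_def mult_single)

lemma lookup_twist: "Poly_Mapping.lookup (twist \<zeta> f) \<gamma> = Poly_Mapping.lookup f (\<zeta> - \<gamma>)"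
  by (simp add: twist_def lookup_q_mult lookup_gbar)

lemma twist_eq: "q (- a) * q b * gbar f = twist (b - a) f"
  using q_add[of "- a" b] by (simp add: twist_def)

lemma twist_zero [simp]: "twist \<zeta> 0 = 0"
  by (simp add: twist_def)

lemma twist_0_one [simp]: "twist 0 1 = 1"
  by (simp add: twist_def q_def)

text \<open>The shifts \<open>L t - L x\<close> and \<open>L y - L t\<close> add up to
  \<open>L y - L x\<close>, so the hat operation respects products in the incidence algebra.\<close>

lemma twist_mult: "twist a f * twist b g = twist (a + b) (f * g)"
  by (simp add: twist_def q_add gbar_mult ac_simps)

lemma twist_sum: "twist \<zeta> (sum f A) = (\<Sum>a\<in>A. twist \<zeta> (f a))"
  by (simp add: twist_def gbar_sum sum_distrib_left)

text \<open>A bound on all exponents instead of on \<open>deg\<close>, so that 0 requires no case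
  distinction.\<close>

definition low :: "'g::linordered_ab_group_add \<Rightarrow> 'g gring \<Rightarrow> bool"
  where "low \<zeta> f \<longleftrightarrow> (\<forall>\<gamma>\<in>Poly_Mapping.keys f. \<gamma> + \<gamma> < \<zeta>)"

lemma deg_less_half_imp_low: "deg_less_half f \<zeta> \<Longrightarrow> low \<zeta> f"
proof (cases "f = 0")
  case False
  assume "deg_less_half f \<zeta>"
  with False have "deg f + deg f < \<zeta>" by (simp add: deg_less_half_def)
  moreover have "\<gamma> \<le> deg f" if "\<gamma> \<in> Poly_Mapping.keys f" for \<gamma>
    using that by (simp add: deg_def)
  ultimately show ?thesis
    unfolding low_def by (meson add_mono order_le_less_trans)
qed (simp add: low_def)

lemma low_mult:
  assumes "low a f" "low b g"
  shows "low (a + b) (f * g)"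
  unfolding low_def
proof
  fix \<gamma> assume "\<gamma> \<in> Poly_Mapping.keys (f * g)"
  then obtain c d where cd: "\<gamma> = c + d" "c \<in> Poly_Mapping.keys f" "d \<in> Poly_Mapping.keys g"
    using keys_mult[of f g] by blast
  then have "c + c < a" "d + d < b" using assms by (auto simp: low_def)
  from add_strict_mono[OF this] show "\<gamma> + \<gamma> < a + b" unfolding cd(1) by (simp add: ac_simps)
qed

lemma low_uminus [simp]: "low a (- f) = low a f"
  by (simp add: low_def in_keys_iff)

lemma low_sum: "(\<And>i. i \<in> A \<Longrightarrow> low a (f i)) \<Longrightarrow> low a (sum f A)"
  using keys_sum[of f A] unfolding low_def by blast

lemma low_eps_mult [simp]: "low a (eps W S w * f) = low a f"
  for f :: "'g::linordered_ab_group_add gring"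
proof -
  have "(eps W S w :: 'g gring) = 1 \<or> eps W S w = (- 1 :: 'g gring)"
    unfolding eps_def by (cases "even (len W S w)") auto
  then show ?thesis by auto
qed

lemma L_half_low: "low \<zeta> f \<Longrightarrow> L_half \<zeta> f = f"
  by (rule poly_mapping_eqI) (auto simp: low_def L_half.rep_eq in_keys_iff)

lemma L_half_add: "L_half \<zeta> (f + g) = L_half \<zeta> f + L_half \<zeta> g"
  by (rule poly_mapping_eqI) (simp add: L_half.rep_eq lookup_add)

lemma L_half_zero [simp]: "L_half \<zeta> 0 = 0"
  by (rule poly_mapping_eqI) (simp add: L_half.rep_eq)

lemma L_half_sum: "L_half \<zeta> (sum f A) = (\<Sum>a\<in>A. L_half \<zeta> (f a))"
  by (induction A rule: infinite_finite_induct) (simp_all add: L_half_add)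

text \<open>Reflection in \<zeta>/2 moves every exponent of \<open>f\<close> above the cut.\<close>

lemma L_half_twist_low:
  assumes "low \<zeta> f"
  shows "L_half \<zeta> (twist \<zeta> f) = 0"
proof (rule poly_mapping_eqI)
  fix \<gamma>
  have "\<zeta> - \<gamma> \<notin> Poly_Mapping.keys f" if "\<gamma> + \<gamma> < \<zeta>"
  proof
    assume "\<zeta> - \<gamma> \<in> Poly_Mapping.keys f"
    then have "(\<zeta> - \<gamma>) + (\<zeta> - \<gamma>) < \<zeta>" using assms by (auto simp: low_def)
    then have "\<zeta> < \<gamma> + \<gamma>" by (simp add: algebra_simps)
    with that show False by simp
  qed
  then show "Poly_Mapping.lookup (L_half \<zeta> (twist \<zeta> f)) \<gamma> = Poly_Mapping.lookup 0 \<gamma>"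
    by (auto simp: L_half.rep_eq lookup_twist in_keys_iff)
qed

text \<open>Replaces the upper truncation in the recursion of \<open>rstar_rev\<close> with a lower
  truncation of the previous value itself.\<close>

lemma U_half_twist: "U_half \<zeta> (twist \<zeta> f) = twist \<zeta> (L_half \<zeta> f)"
proof (rule poly_mapping_eqI)
  fix \<gamma>
  have "\<zeta> < \<gamma> + \<gamma> \<longleftrightarrow> (\<zeta> - \<gamma>) + (\<zeta> - \<gamma>) < \<zeta>" by (simp add: algebra_simps)
  then show "Poly_Mapping.lookup (U_half \<zeta> (twist \<zeta> f)) \<gamma> =
      Poly_Mapping.lookup (twist \<zeta> (L_half \<zeta> f)) \<gamma>"
    by (simp add: U_half.rep_eq L_half.rep_eq lookup_twist)
qed

lemma L_half_U_half: "L_half \<zeta> (U_half \<zeta> f) = 0"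
  by (rule poly_mapping_eqI) (auto simp: U_half.rep_eq L_half.rep_eq)

text \<open>The exponent 0 lies exactly on the cut, and the inequality in the truncation is
  strict.\<close>

lemma L_half_0_one: "L_half 0 1 = 0"
  by (rule poly_mapping_eqI) (auto simp: L_half.rep_eq lookup_one when_def)

section \<open>The inverse Kazhdan--Lusztig recursion\<close>

locale KL_inversion = coxeter_system W S
  for W :: "('w, 'b) monoid_scheme" (structure) and S :: "'w set" +
  fixes E :: "'w set"
    and L :: "'w \<Rightarrow> 'g::linordered_ab_group_add"
    and R P Q :: "'w \<Rightarrow> 'w \<Rightarrow> 'g gring"
  assumes E_subset: "E \<subseteq> carrier W"
    and KL: "is_KL_family W S L E R P"
    and inverse_KL: "is_inverse_KL_family W S E P Q"
begin

abbreviation le where "le \<equiv> bruhat_le W S"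
abbreviation less where "less \<equiv> bruhat_less W S"
abbreviation I where "I \<equiv> E_interval W S E"

definition sP where "sP x y = eps W S x * eps W S y * P x y"
definition sR where "sR x y = eps W S x * eps W S y * R x y"

lemma finite_I [simp]: "y \<in> E \<Longrightarrow> finite (I x y)"
  using finite_bruhat_le[of y] E_subset
  by (auto simp: E_interval_def intro: rev_finite_subset)

lemma I_memD: "t \<in> I x y \<Longrightarrow> t \<in> E" "t \<in> I x y \<Longrightarrow> le x t" "t \<in> I x y \<Longrightarrow> le t y"
  by (auto simp: E_interval_def)

lemma sum_I_split: "\<lbrakk>y \<in> E; le x y\<rbrakk> \<Longrightarrow> sum h (I x y) = h y + sum h (I x y - {y})"
  by (rule sum.remove) (simp_all, simp add: E_interval_def)

text \<open>Both sides run over all \<open>x \<le> t \<le> u \<le> y\<close> in \<open>E\<close>;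
  this gives associativity of the product in the incidence algebra.\<close>

lemma sum_I_swap:
  assumes "y \<in> E"
  shows "(\<Sum>u\<in>I x y. \<Sum>t\<in>I x u. f t u) = (\<Sum>t\<in>I x y. \<Sum>u\<in>I t y. f t u)"
proof -
  have "(\<Sum>u\<in>I x y. \<Sum>t\<in>I x u. f t u) = (\<Sum>u\<in>I x y. \<Sum>t\<in>{t \<in> I x y. le t u}. f t u)"
    by (intro sum.cong) (auto simp: E_interval_def intro: bruhat_le_trans)
  also have "\<dots> = (\<Sum>t\<in>I x y. \<Sum>u\<in>{u \<in> I x y. le t u}. f t u)"
    using assms by (intro sum.swap_restrict) auto
  also have "\<dots> = (\<Sum>t\<in>I x y. \<Sum>u\<in>I t y. f t u)"
    by (intro sum.cong) (auto simp: E_interval_def intro: bruhat_le_trans)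
  finally show ?thesis .
qed

lemma sP_refl [simp]: "x \<in> E \<Longrightarrow> sP x x = 1"
  using KL by (simp add: sP_def is_KL_family_def)

lemma low_sP: "\<lbrakk>x \<in> E; y \<in> E; less x y\<rbrakk> \<Longrightarrow> low (L y - L x) (sP x y)"
  using KL by (simp add: sP_def mult.assoc is_KL_family_def deg_less_half_imp_low)

lemma Q_sP:
  assumes "x \<in> E" "y \<in> E"
  shows "(\<Sum>t\<in>I x y. Q x t * sP t y) = (if x = y then 1 else 0)"
proof -
  have eq: "Q x t * sP t y = eps W S t * eps W S y * Q x t * P t y" for t
    by (simp add: sP_def ac_simps)
  show ?thesis unfolding eq using inverse_KL assms by (simp add: is_inverse_KL_family_def)
qed

lemma twist_sP:
  assumes "x \<in> E" "y \<in> E"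
  shows "twist (L y - L x) (sP x y) = (\<Sum>t\<in>I x y. sR x t * sP t y)"
proof -
  have "twist (L y - L x) (sP x y) = eps W S x * eps W S y * (q (- L x) * q (L y) * gbar (P x y))"
    by (simp add: sP_def twist_eq[symmetric] gbar_mult ac_simps)
  also have "\<dots> = eps W S x * eps W S y * (\<Sum>t\<in>I x y. R x t * P t y)"
    using KL assms by (simp add: is_KL_family_def)
  also have "\<dots> = (\<Sum>t\<in>I x y. sR x t * sP t y)"
    unfolding sum_distrib_left
  proof (rule sum.cong)
    fix t
    have "sR x t * sP t y =
        (eps W S t * eps W S t) * (eps W S x * eps W S y * (R x t * P t y))"
      unfolding sR_def sP_def by (simp only: ac_simps)
    then show "eps W S x * eps W S y * (R x t * P t y) = sR x t * sP t y" by simp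
  qed simp
  finally show ?thesis .
qed

text \<open>Right cancellation of a unitriangular family: in the equation at \<open>y\<close> the
  term \<open>t = y\<close> has coefficient 1, and the other terms agree by induction on the
  length.\<close>

lemma sP_cancel:
  assumes "\<And>y. y \<in> E \<Longrightarrow> (\<Sum>t\<in>I x y. f t * sP t y) = (\<Sum>t\<in>I x y. g t * sP t y)"
    and "y \<in> E" "le x y"
  shows "f y = g y"
  using assms(2,3)
proof (induction y rule: measure_induct_rule[of "len W S"])
  case (less y)
  have "f t = g t" if "t \<in> I x y - {y}" for t
    using that by (intro less.IH bruhat_less_len) (auto simp: E_interval_def bruhat_less_def)
  then have "(\<Sum>t\<in>I x y - {y}. f t * sP t y) = (\<Sum>t\<in>I x y - {y}. g t * sP t y)"
    by simp
  moreover have "(\<Sum>t\<in>I x y. h t * sP t y) = h y + (\<Sum>t\<in>I x y - {y}. h t * sP t y)" for h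
    using sum_I_split[OF less.prems, of "\<lambda>t. h t * sP t y"] less.prems by simp
  ultimately show ?case
    using assms(1)[OF less.prems(1)] by simp
qed

lemma Q_refl [simp]: "x \<in> E \<Longrightarrow> Q x x = 1"
  using Q_sP[of x x] by (simp add: E_interval_refl)

lemma sR_refl [simp]: "x \<in> E \<Longrightarrow> sR x x = 1"
  using twist_sP[of x x] by (simp add: E_interval_refl)

text \<open>Solving \<open>Q_sP\<close> for \<open>Q x y\<close> leaves products over
  \<open>t \<noteq> y\<close>, whose two degree bounds add up to the required one.\<close>

lemma low_Q:
  assumes "x \<in> E" "y \<in> E" "less x y"
  shows "low (L y - L x) (Q x y)"
  using assms(2,3)
proof (induction y rule: measure_induct_rule[of "len W S"])
  case (less y)
  have le: "le x y" "x \<noteq> y" using less.prems by (auto simp: bruhat_less_def)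
  have "(\<Sum>t\<in>I x y. Q x t * sP t y) = Q x y + (\<Sum>t\<in>I x y - {y}. Q x t * sP t y)"
    using sum_I_split[OF less.prems(1) le(1), of "\<lambda>t. Q x t * sP t y"] less.prems by simp
  then have Q: "Q x y = - (\<Sum>t\<in>I x y - {y}. Q x t * sP t y)"
    using Q_sP[OF assms(1) less.prems(1)] le by (simp add: eq_neg_iff_add_eq_0)
  have "low (L y - L x) (Q x t * sP t y)" if t: "t \<in> I x y - {y}" for t
  proof -
    have tE: "t \<in> E" and ty: "less t y" using t by (auto simp: E_interval_def bruhat_less_def)
    show ?thesis
    proof (cases "t = x")
      \<comment> \<open>\<open>Q x x = 1\<close> is not strictly below the cut at 0, so the whole
        bound has to come from \<open>sP\<close>.\<close>
      case True
      then show ?thesis using assms(1) low_sP less.prems by simp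
    next
      case False
      then have "less x t" using t by (auto simp: E_interval_def bruhat_less_def)
      from low_mult[OF less.IH[OF bruhat_less_len[OF ty] tE this] low_sP[OF tE less.prems(1) ty]]
      show ?thesis by simp
    qed
  qed
  then show ?case unfolding Q low_uminus by (rule low_sum)
qed

text \<open>The hat operation turns \<open>Q * sP = 1\<close> into \<open>Q^ * sP^ = 1\<close>.
  Inserting \<open>sP^ = sR * sP\<close> gives \<open>(Q^ * sR) * sP = Q * sP\<close>, and
  \<open>sP\<close> cancels.\<close>

lemma Q_eq_sum_twist:
  assumes "x \<in> E" "y \<in> E" "le x y"
  shows "Q x y = (\<Sum>t\<in>I x y. twist (L t - L x) (Q x t) * sR t y)"
proof (rule sP_cancel[OF _ assms(2,3), symmetric])
  fix y assume y: "y \<in> E"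
  have "(\<Sum>u\<in>I x y. (\<Sum>t\<in>I x u. twist (L t - L x) (Q x t) * sR t u) * sP u y)
    = (\<Sum>u\<in>I x y. \<Sum>t\<in>I x u. twist (L t - L x) (Q x t) * (sR t u * sP u y))"
    by (simp add: sum_distrib_right mult.assoc)
  also have "\<dots> = (\<Sum>t\<in>I x y. twist (L t - L x) (Q x t) * (\<Sum>u\<in>I t y. sR t u * sP u y))"
    by (simp add: sum_I_swap[OF y] sum_distrib_left)
  also have "\<dots> = (\<Sum>t\<in>I x y. twist (L t - L x) (Q x t) * twist (L y - L t) (sP t y))"
    using y by (intro sum.cong) (auto simp: twist_sP I_memD)
  also have "\<dots> = twist (L y - L x) (\<Sum>t\<in>I x y. Q x t * sP t y)"
    by (simp add: twist_mult twist_sum)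
  \<comment> \<open>The sum is 0 or, if \<open>x = y\<close>, 1. In the latter case the shift is 0,
    so \<open>twist\<close> fixes both values.\<close>
  also have "\<dots> = (\<Sum>t\<in>I x y. Q x t * sP t y)"
    using Q_sP[OF assms(1) y] by simp
  finally show "(\<Sum>u\<in>I x y. (\<Sum>t\<in>I x u. twist (L t - L x) (Q x t) * sR t u) * sP u y)
    = (\<Sum>t\<in>I x y. Q x t * sP t y)" .
qed

end

section \<open>Sums over chains and multichains\<close>

lemma length_ge_2_obtains_snoc:
  assumes "2 \<le> length xs"
  obtains ys where "xs = ys @ [last xs]" "ys \<noteq> []"
proof
  show "xs = butlast xs @ [last xs]" using assms by (intro append_butlast_last_id[symmetric]) auto
  show "butlast xs \<noteq> []" using assms by (cases xs rule: remdups_adj.cases) auto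
qed

lemma E_chains_iff:
  "xs \<in> E_chains W S E x y \<longleftrightarrow> 2 \<le> length xs \<and> hd xs = x \<and> last xs = y \<and>
    set xs \<subseteq> E \<and> successively (bruhat_less W S) xs"
  by (auto simp: E_chains_def chains_k_def le_iff_add)

lemma E_multichains_iff:
  "xs \<in> E_multichains W S E x y \<longleftrightarrow> 2 \<le> length xs \<and> hd xs = x \<and> last xs = y \<and>
    set xs \<subseteq> E \<and> successively (bruhat_le W S) xs"
  by (auto simp: E_multichains_def multichains_k_def le_iff_add)

lemma E_chains_subset_multichains: "E_chains W S E x y \<subseteq> E_multichains W S E x y"
  by (auto simp: E_chains_iff E_multichains_iff bruhat_less_def elim: successively_mono)

lemma chain_hd_less_last:
  assumes "successively (bruhat_less W S) xs" "2 \<le> length xs"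
  shows "bruhat_less W S (hd xs) (last xs)"
  using assms
proof (induction xs rule: induct_list012)
  case (3 a b xs)
  then show ?case by (cases xs) (auto intro: bruhat_less_trans)
qed simp_all

text \<open>Classification by the penultimate entry: it is \<open>x\<close> exactly for the chain
  \<open>[x, y]\<close>, and otherwise lies strictly between \<open>x\<close> and
  \<open>y\<close>.\<close>

lemma E_chains_rec:
  assumes "x \<in> E" "y \<in> E" "bruhat_less W S x y"
  shows "E_chains W S E x y =
    insert [x, y] (\<Union>z\<in>E_interval W S E x y - {x, y}. (\<lambda>xs. xs @ [y]) ` E_chains W S E x z)"
    (is "_ = ?rhs")
proof (intro equalityI subsetI)
  fix xs assume xs: "xs \<in> E_chains W S E x y"
  then obtain ys where ys: "xs = ys @ [y]" "ys \<noteq> []"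
    using length_ge_2_obtains_snoc[of xs] by (auto simp: E_chains_iff)
  show "xs \<in> ?rhs"
  proof (cases "2 \<le> length ys")
    case True
    then have c: "ys \<in> E_chains W S E x (last ys)" and y: "bruhat_less W S (last ys) y"
      using xs ys by (auto simp: E_chains_iff successively_append_iff)
    have "bruhat_less W S x (last ys)"
      using chain_hd_less_last[of W S ys] c by (simp add: E_chains_iff)
    then have "last ys \<in> E_interval W S E x y - {x, y}"
      using y c ys(2) by (auto simp: E_interval_def bruhat_less_def E_chains_iff)
    with c ys(1) show ?thesis by blast
  next
    case False
    then obtain a where "ys = [a]" using ys(2) by (cases ys) (auto simp: Suc_le_eq)
    with xs ys show ?thesis by (simp add: E_chains_iff)
  qed
next
  fix xs assume "xs \<in> ?rhs"
  then consider "xs = [x, y]"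
    | z ys where "z \<in> E_interval W S E x y - {x, y}" "ys \<in> E_chains W S E x z" "xs = ys @ [y]"
    by auto
  then show "xs \<in> E_chains W S E x y"
  proof cases
    case 1
    with assms show ?thesis by (simp add: E_chains_iff)
  next
    case 2
    then have "ys \<noteq> []" by (auto simp: E_chains_iff)
    with 2 assms show ?thesis
      by (auto simp: E_chains_iff E_interval_def successively_append_iff bruhat_less_def)
  qed
qed

section \<open>The polynomials of multichains when an entry is appended\<close>

lemma rstar_pair [simp]: "rstar L Rt [x, y] = rstar2 L Rt x y"
  by (simp add: rstar_def)

text \<open>For fixed end points of \<open>xs\<close> the right side is additive in
  \<open>rstar L Rt xs\<close>, so sums over chains can be moved inside the truncation.\<close>

lemma rstar_append:
  assumes "2 \<le> length xs"
  shows "rstar L Rt (xs @ [y]) =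
    twist (L (last xs) - L (hd xs)) (L_half (L (last xs) - L (hd xs)) (rstar L Rt xs)) *
      rstar2 L Rt (last xs) y"
proof -
  obtain z w us where r: "rev xs = z # w # us"
    using assms by (cases "rev xs" rule: remdups_adj.cases) auto
  have "last (w # us) = last (rev xs)" unfolding r by simp
  also have "\<dots> = hd xs" using assms by (cases xs) auto
  finally have "last (w # us) = hd xs" .
  moreover have "z = last xs" using r assms by (metis hd_rev list.sel(1))
  ultimately show ?thesis
    unfolding rstar_def rev_append
    by (simp add: r Let_def twist_eq U_half_twist)
qed

context KL_inversion
begin

lemma rstar2_dual_R: "rstar2 L (dual_R W S L R) x y = sR x y"
proof -
  have "rstar2 L (dual_R W S L R) x y =
      eps W S x * eps W S y * R x y * ((q (- L x) * q (L x)) * (q (L y) * q (- L y)))"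
    unfolding rstar2_def dual_R_def gbar_mult gbar_eps gbar_q gbar_gbar minus_minus
    by (simp only: ac_simps)
  then show ?thesis by (simp add: sR_def)
qed

abbreviation rs where "rs \<equiv> rstar L (dual_R W S L R)"

lemma finite_E_chains:
  assumes "x \<in> E" "y \<in> E"
  shows "finite (E_chains W S E x y)"
  using assms(2)
proof (induction y rule: measure_induct_rule[of "len W S"])
  case (less y)
  show ?case
  proof (cases "less x y")
    case True
    have "finite (E_chains W S E x z)" if "z \<in> I x y - {x, y}" for z
      using that by (intro less.IH bruhat_less_len) (auto simp: E_interval_def bruhat_less_def)
    then show ?thesis
      using less.prems unfolding E_chains_rec[OF assms(1) less.prems True] by simp
  next
    case False
    then have "E_chains W S E x y = {}"
      using chain_hd_less_last by (fastforce simp: E_chains_iff)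
    then show ?thesis by simp
  qed
qed

lemma sum_chains_rec:
  assumes "x \<in> E" "y \<in> E" "less x y"
  shows "sum rs (E_chains W S E x y) = sR x y +
    (\<Sum>z\<in>I x y - {x, y}. twist (L z - L x) (L_half (L z - L x) (sum rs (E_chains W S E x z))) * sR z y)"
proof -
  let ?C = "\<lambda>z. (\<lambda>xs. xs @ [y]) ` E_chains W S E x z"
  let ?U = "\<Union>z\<in>I x y - {x, y}. ?C z"
  have fin: "finite (?C z)" if "z \<in> I x y - {x, y}" for z
    using that assms(1) by (intro finite_imageI finite_E_chains) (auto simp: I_memD)
  have "[x, y] \<notin> ?U"
    by (auto simp: E_chains_iff Cons_eq_append_conv)
  then have "sum rs (E_chains W S E x y) = sR x y + sum rs ?U"
    using fin assms unfolding E_chains_rec[OF assms] by (subst sum.insert) (auto simp: rstar2_dual_R)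
  \<comment> \<open>The union is disjoint because \<open>z\<close> is the penultimate entry of every
    list in \<open>?C z\<close>.\<close>
  also have "sum rs ?U = (\<Sum>z\<in>I x y - {x, y}. sum rs (?C z))"
    using fin assms by (intro sum.UNION_disjoint) (auto simp: E_chains_iff)
  also have "\<dots> = (\<Sum>z\<in>I x y - {x, y}. twist (L z - L x)
      (L_half (L z - L x) (sum rs (E_chains W S E x z))) * sR z y)"
  proof (rule sum.cong)
    fix z
    have "sum rs (?C z) = (\<Sum>xs\<in>E_chains W S E x z. rs (xs @ [y]))"
      by (subst sum.reindex) (auto simp: inj_on_def)
    also have "\<dots> = (\<Sum>xs\<in>E_chains W S E x z.
        twist (L z - L x) (L_half (L z - L x) (rs xs)) * sR z y)"
      by (intro sum.cong) (auto simp: E_chains_iff rstar_append rstar2_dual_R)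
    finally show "sum rs (?C z) = twist (L z - L x)
        (L_half (L z - L x) (sum rs (E_chains W S E x z))) * sR z y"
      by (simp add: L_half_sum twist_sum sum_distrib_right)
  qed simp
  finally show ?thesis .
qed

text \<open>By induction, \<open>sum_chains_rec\<close> and \<open>Q_eq_sum_twist\<close> have the
  same terms strictly between \<open>x\<close> and \<open>y\<close>. Of the remaining terms of the
  latter, \<open>t = x\<close> gives \<open>sR x y\<close> and \<open>t = y\<close> gives the twist
  of \<open>Q x y\<close>.\<close>

lemma L_half_sum_chains:
  assumes "x \<in> E" "y \<in> E" "less x y"
  shows "L_half (L y - L x) (sum rs (E_chains W S E x y)) = Q x y"
    and "Q x y = sum rs (E_chains W S E x y) + twist (L y - L x) (Q x y)"
proof -
  have "L_half (L y - L x) (sum rs (E_chains W S E x y)) = Q x y \<and>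
    Q x y = sum rs (E_chains W S E x y) + twist (L y - L x) (Q x y)"
    using assms(2,3)
  proof (induction y rule: measure_induct_rule[of "len W S"])
    case (less y)
    have le: "le x y" "x \<noteq> y" using less.prems by (auto simp: bruhat_less_def)
    let ?g = "\<lambda>z. twist (L z - L x) (Q x z) * sR z y"
    have "sum rs (E_chains W S E x y) = sR x y + sum ?g (I x y - {x, y})"
      unfolding sum_chains_rec[OF assms(1) less.prems]
    proof (intro arg_cong2[where f = "(+)"] sum.cong refl)
      fix z assume "z \<in> I x y - {x, y}"
      then have "z \<in> E" "less z y" "less x z" by (auto simp: E_interval_def bruhat_less_def)
      then show "twist (L z - L x) (L_half (L z - L x) (sum rs (E_chains W S E x z))) * sR z y = ?g z"
        using less.IH[OF bruhat_less_len] by simp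
    qed
    moreover have "Q x y = ?g y + (?g x + sum ?g (I x y - {x, y}))"
    proof -
      have "Q x y = ?g y + sum ?g (I x y - {y})"
        using Q_eq_sum_twist[OF assms(1) less.prems(1) le(1)]
        by (rule trans) (rule sum_I_split[OF less.prems(1) le(1)])
      also have "sum ?g (I x y - {y}) = ?g x + sum ?g (I x y - {y} - {x})"
        using assms(1) less.prems(1) le by (intro sum.remove) (simp_all, simp add: E_interval_def)
      also have "I x y - {y} - {x} = I x y - {x, y}" by auto
      finally show ?thesis .
    qed
    ultimately have Q: "Q x y = sum rs (E_chains W S E x y) + twist (L y - L x) (Q x y)"
      using assms(1) less.prems(1) by (simp add: add.commute)
    \<comment> \<open>Truncation separates the two terms of \<open>Q\<close>: the exponents of
      \<open>Q x y\<close> are below the cut, those of its twist above.\<close>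
    have low: "low (L y - L x) (Q x y)" by (rule low_Q[OF assms(1) less.prems])
    have "Q x y = L_half (L y - L x) (Q x y)" using L_half_low[OF low] by simp
    also have "\<dots> = L_half (L y - L x) (sum rs (E_chains W S E x y))"
      by (subst Q) (simp add: L_half_add L_half_twist_low[OF low])
    finally show ?case using Q by simp
  qed
  then show "L_half (L y - L x) (sum rs (E_chains W S E x y)) = Q x y"
    and "Q x y = sum rs (E_chains W S E x y) + twist (L y - L x) (Q x y)" by auto
qed

text \<open>Since \<open>sR z z = 1\<close>, repeating \<open>z\<close> leaves just an upper
  truncation, which the lower truncation at the same point, taken when \<open>y\<close> is appended,
  annihilates. If \<open>us\<close> is empty, the value 1 at \<open>[z, z]\<close> is removed by the
  cut at 0.\<close>

lemma rstar_repeat: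
  assumes "z \<in> E"
  shows "rs (us @ [z, z] @ [y]) = 0"
proof (cases "us = []")
  case True
  then show ?thesis
    using assms rstar_append[of "[z, z]" L "dual_R W S L R" y]
    by (simp add: rstar2_dual_R L_half_0_one)
next
  case False
  then have 1: "2 \<le> length (us @ [z])" "2 \<le> length (us @ [z, z])"
    by (cases us; simp)+
  have "rs (us @ [z, z]) = U_half (L z - L (hd us)) (twist (L z - L (hd us)) (rs (us @ [z])))"
    using assms False rstar_append[OF 1(1), of L "dual_R W S L R" z]
    by (simp add: rstar2_dual_R U_half_twist)
  then show ?thesis
    using False rstar_append[OF 1(2), of L "dual_R W S L R" y] by (simp add: L_half_U_half)
qed

text \<open>A value 0 stays 0 when entries are appended. The last pair may coincide, as no
  truncation follows it; hence \<open>butlast\<close>.\<close>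

lemma rstar_nonzero:
  assumes "successively le xs" "set xs \<subseteq> E" "2 \<le> length xs" "rs xs \<noteq> 0"
  shows "successively less (butlast xs)"
  using assms
proof (induction xs rule: rev_induct)
  case (snoc y ys)
  show ?case
  proof (cases "2 \<le> length ys")
    case False
    then show ?thesis by (cases ys) (auto simp: Suc_le_eq)
  next
    case True
    then obtain zs z where ys: "ys = zs @ [z]" "zs \<noteq> []"
      by (rule length_ge_2_obtains_snoc)
    have "rs ys \<noteq> 0"
      using snoc.prems(4) rstar_append[OF True, of L "dual_R W S L R" y] by auto
    then have "successively less (butlast ys)"
      using snoc True by (simp add: successively_append_iff)
    moreover have "last zs \<noteq> z"
    proof
      assume "last zs = z"
      then have "zs = butlast zs @ [z]"
        using ys(2) append_butlast_last_id[of zs] by simp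
      then have eq: "ys @ [y] = butlast zs @ [z, z] @ [y]" unfolding ys(1) by simp
      have "z \<in> E" using snoc.prems(2) ys(1) by simp
      from rstar_repeat[OF this] snoc.prems(4) show False unfolding eq by simp
    qed
    moreover have "le (last zs) z"
      using snoc.prems(1) ys by (simp add: successively_append_iff)
    ultimately show ?thesis
      unfolding butlast_snoc ys(1) by (simp add: successively_append_iff bruhat_less_def)
  qed
qed simp

lemma nonzero_multichains_subset:
  assumes "less x y"
  shows "{xs \<in> E_multichains W S E x y. rs xs \<noteq> 0} \<subseteq>
    E_chains W S E x y \<union> (\<lambda>xs. xs @ [y]) ` E_chains W S E x y"
proof
  fix xs assume "xs \<in> {xs \<in> E_multichains W S E x y. rs xs \<noteq> 0}"
  then have xs: "2 \<le> length xs" "hd xs = x" "last xs = y" "set xs \<subseteq> E" "successively le xs" "rs xs \<noteq> 0"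
    by (auto simp: E_multichains_iff)
  from rstar_nonzero[OF xs(5,4,1,6)] have s: "successively less (butlast xs)" .
  obtain ys where ys: "xs = ys @ [y]" "ys \<noteq> []"
    using length_ge_2_obtains_snoc[OF xs(1)] xs(3) by metis
  have le: "le (last ys) y" using xs(5) ys by (simp add: successively_append_iff)
  have hd: "hd ys = x" using xs(2) ys by simp
  show "xs \<in> E_chains W S E x y \<union> (\<lambda>xs. xs @ [y]) ` E_chains W S E x y"
  proof (cases "last ys = y")
    case False
    then have "xs \<in> E_chains W S E x y"
      using xs s ys le by (auto simp: E_chains_iff successively_append_iff bruhat_less_def)
    then show ?thesis by simp
  next
    case True
    \<comment> \<open>A single entry would be both \<open>x\<close> and \<open>y\<close>.\<close>
    have "2 \<le> length ys"
    proof (rule ccontr)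
      assume "\<not> 2 \<le> length ys"
      then obtain a where "ys = [a]" using ys(2) by (cases ys) (auto simp: Suc_le_eq)
      with True hd assms show False by (simp add: bruhat_less_def)
    qed
    then have "ys \<in> E_chains W S E x y"
      using xs s ys hd True by (simp add: E_chains_iff)
    then show ?thesis using ys(1) by simp
  qed
qed

text \<open>For \<open>x < y\<close> the chains and the chains with \<open>y\<close> repeated
  contribute the two summands in the second equation of \<open>L_half_sum_chains\<close>. For
  \<open>x = y\<close> only \<open>[x, x]\<close> remains, with value 1.\<close>

lemma sum_multichains:
  assumes "x \<in> E" "y \<in> E" "le x y"
  defines "N \<equiv> {xs \<in> E_multichains W S E x y. rs xs \<noteq> 0}"
  shows "finite N \<and> Q x y = sum rs N"
proof (cases "x = y")
  case True
  have "N = {[x, x]}"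
  proof (intro equalityI subsetI)
    fix xs assume "xs \<in> N"
    then have xs: "2 \<le> length xs" "hd xs = x" "last xs = x" "set xs \<subseteq> E" "successively le xs" "rs xs \<noteq> 0"
      using True by (auto simp: E_multichains_iff N_def)
    from rstar_nonzero[OF xs(5,4,1,6)] have s: "successively less (butlast xs)" .
    obtain ys where ys: "xs = ys @ [x]" "ys \<noteq> []"
      using length_ge_2_obtains_snoc[OF xs(1)] xs(3) by metis
    have "le (last ys) x" using xs(5) ys by (simp add: successively_append_iff)
    moreover have "hd ys = x" using xs(2) ys by simp
    ultimately have "\<not> 2 \<le> length ys"
      using chain_hd_less_last[of W S ys] s ys(1) by (auto simp: bruhat_less_def dest: bruhat_le_antisym)
    then obtain a where "ys = [a]" using ys(2) by (cases ys) (auto simp: Suc_le_eq)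
    with ys \<open>hd ys = x\<close> show "xs \<in> {[x, x]}" by simp
  next
    fix xs assume "xs \<in> {[x, x]}"
    then show "xs \<in> N" using True assms(1) by (simp add: N_def E_multichains_iff rstar2_dual_R)
  qed
  then show ?thesis using True assms(1) by (simp add: rstar2_dual_R)
next
  case False
  with assms have xy: "less x y" by (simp add: bruhat_less_def)
  let ?C = "E_chains W S E x y"
  let ?D = "(\<lambda>xs. xs @ [y]) ` ?C"
  have fin: "finite ?C" by (rule finite_E_chains[OF assms(1,2)])
  have sub: "N \<subseteq> ?C \<union> ?D" unfolding N_def by (rule nonzero_multichains_subset[OF xy])
  have "?C \<subseteq> E_multichains W S E x y" by (rule E_chains_subset_multichains)
  moreover have "?D \<subseteq> E_multichains W S E x y"
  proof
    fix xs assume "xs \<in> ?D"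
    then obtain ys where "xs = ys @ [y]" "ys \<in> E_multichains W S E x y"
      using E_chains_subset_multichains[of W S E x y] by auto
    moreover from this have "ys \<noteq> []" by (auto simp: E_multichains_iff)
    ultimately show "xs \<in> E_multichains W S E x y"
      by (auto simp: E_multichains_iff successively_append_iff)
  qed
  ultimately have "\<forall>xs\<in>?C \<union> ?D - N. rs xs = 0"
    unfolding N_def by auto
  then have "sum rs N = sum rs (?C \<union> ?D)"
    using fin sub by (intro sum.mono_neutral_left) auto
  also have "\<dots> = sum rs ?C + sum rs ?D"
  proof (rule sum.union_disjoint)
    \<comment> \<open>Lists in \<open>?D\<close> end in \<open>y\<close>, \<open>y\<close>, which
      strictness forbids in \<open>?C\<close>.\<close>
    show "?C \<inter> ?D = {}"
    proof (intro equals0I)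
      fix xs assume "xs \<in> ?C \<inter> ?D"
      then obtain ys where ys: "ys \<in> ?C" "ys @ [y] \<in> ?C" by auto
      then have "ys \<noteq> []" by (auto simp: E_chains_iff)
      with ys show False by (simp add: E_chains_iff successively_append_iff bruhat_less_def)
    qed
  qed (use fin in auto)
  \<comment> \<open>The last factor is \<open>sR y y = 1\<close>, so only the twisted truncation is
    left.\<close>
  also have "sum rs ?D = twist (L y - L x) (L_half (L y - L x) (sum rs ?C))"
  proof -
    have "sum rs ?D = (\<Sum>xs\<in>?C. rs (xs @ [y]))"
      by (subst sum.reindex) (auto simp: inj_on_def)
    also have "\<dots> = (\<Sum>xs\<in>?C. twist (L y - L x) (L_half (L y - L x) (rs xs)))"
      using assms(2) by (intro sum.cong) (auto simp: E_chains_iff rstar_append rstar2_dual_R)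
    finally show ?thesis by (simp add: L_half_sum twist_sum)
  qed
  finally have "sum rs N = Q x y"
    using L_half_sum_chains[OF assms(1,2) xy] by simp
  moreover have "finite N" using fin by (intro finite_subset[OF sub]) simp
  ultimately show ?thesis by simp
qed

end

theorem theorem7p4:
  fixes W :: "('w, 'b) monoid_scheme"
    and S E J :: "'w set"
    and L :: "'w \<Rightarrow> 'g::linordered_ab_group_add"
    and hscale :: "'g gring \<Rightarrow> 'h::ring_1 \<Rightarrow> 'h"
    and T :: "'w \<Rightarrow> 'h"
    and hbar :: "'h \<Rightarrow> 'h"
    and mscale :: "'g gring \<Rightarrow> 'm::ab_group_add \<Rightarrow> 'm"
    and act :: "'h \<Rightarrow> 'm \<Rightarrow> 'm"
    and G :: "'w \<Rightarrow> 'm"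
    and mbar :: "'m \<Rightarrow> 'm"
    and R Rt P Q :: "'w \<Rightarrow> 'w \<Rightarrow> 'g gring"
    and x y :: 'w
  assumes "W_graph_ideal W S L hscale T hbar mscale E J act G mbar"
    and "R = R_poly W S L E mscale G mbar"
    and "Rt = dual_R W S L R"
    and "is_KL_family W S L E R P"
    and "is_inverse_KL_family W S E P Q"
    and "x \<in> E" and "y \<in> E"
  shows "(bruhat_less W S x y \<longrightarrow>
      Q x y = L_half (L y - L x) (\<Sum>\<phi>\<in>E_chains W S E x y. rstar L Rt \<phi>)) \<and>
    (bruhat_le W S x y \<longrightarrow>
      finite {\<phi> \<in> E_multichains W S E x y. rstar L Rt \<phi> \<noteq> 0} \<and>
      Q x y = (\<Sum>\<phi>\<in>{\<phi> \<in> E_multichains W S E x y. rstar L Rt \<phi> \<noteq> 0}. rstar L Rt \<phi>))"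
proof -
  interpret W_graph_ideal W S L hscale T hbar mscale E J act G mbar by (rule assms(1))
  interpret KL_inversion W S E L R P Q
    by unfold_locales (use E_carrier assms in auto)
  show ?thesis
    using L_half_sum_chains(1)[OF assms(6,7)] sum_multichains[OF assms(6,7)]
    unfolding assms(3) by auto
qed

end
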